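(* Let $P(y) \in \mathbb{Z}[y]$ have degree at least $2$ with $P(0) = 0$, and let $F(x,y) = x - P(y)$. Then for every $B \subset \mathbb{Z}^2$ of positive upper Banach density, the set $F(B - B) = \{F(u) : u \in B - B\}$ contains a non-trivial subgroup of $\mathbb{Z}$, i.e. there is an integer $k \geq 1$ with $k\mathbb{Z} \subset F(B-B)$.
   Context: Upper Banach density of $B \subset \mathbb{Z}^d$: $d^*(B) = \limsup_{R \to \infty} \sup_{x \in \mathbb{Z}^d} \frac{|B \cap (x + [0,R)^d)|}{R^d}$; positive means $d^*(B)>0$. $B - B = \{b_1 - b_2 : b_1, b_2 \in B\}$. *)

theory Defs
  imports "HOL-Analysis.Analysis" "HOL-Computational_Algebra.Polynomial"
begin

definition box2 :: "int \<times> int \<Rightarrow> nat \<Rightarrow> (int \<times> int) set" where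
  "box2 x R = {(a, b). fst x \<le> a \<and> a < fst x + int R \<and> snd x \<le> b \<and> b < snd x + int R}"

definition upper_banach_density2 :: "(int \<times> int) set \<Rightarrow> ereal" where
  "upper_banach_density2 B =
     limsup (\<lambda>R::nat. SUP x. ereal (real (card (B \<inter> box2 x R)) / real R ^ 2))"

definition diffset :: "(int \<times> int) set \<Rightarrow> (int \<times> int) set" where
  "diffset B = {b1 - b2 | b1 b2. b1 \<in> B \<and> b2 \<in> B}"

end

theory Submission
  imports Defs "HOL-Real_Asymp.Real_Asymp"
begin

text \<open>
  A limit of averages over boxes in which \<open>B\<close> stays dense gives a semi-inner product \<open>\<Lambda>\<close> on the bounded
  functions on \<open>\<int>\<^sup>2\<close> that is invariant under the translations \<open>T\<close>. With \<open>f\<close> the indicator function of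
  \<open>B\<close>, it suffices to find \<open>k\<close> such that for every \<open>n\<close> the correlation \<open>\<Lambda> f (T (k n + P y, y) f)\<close> is
  positive for some \<open>y\<close>.

  Split \<open>f = f' + g\<close>, where \<open>f'\<close> is an almost norm-minimal convex combination of the translates
  \<open>T (m j, 0) f\<close>, with \<open>m\<close> chosen such that replacing \<open>m\<close> by a multiple hardly changes the minimal norm.
  Then \<open>f'\<close> is almost invariant under \<open>T (m, 0)\<close>, and \<open>g\<close> has almost no rational spectrum in the first
  coordinate. As \<open>P\<close> has degree at least 2, van der Corput's inequality turns the latter into smallness of
  the averages of \<open>T (m n + P (m y), m y) g\<close> over \<open>y\<close>, uniformly in \<open>n\<close>. As \<open>m\<close> divides
  \<open>m n + P (m y)\<close>, the remaining part is almost the average of \<open>\<Lambda> f' (T (0, m y) f')\<close>, which is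
  frequently close to at least the square of the density. So \<open>k = m\<close> works.
\<close>

subsection \<open>Averages and differences of polynomials\<close>

definition av :: "nat \<Rightarrow> (nat \<Rightarrow> 'a::real_vector) \<Rightarrow> 'a" where
  "av N u = (1 / real N) *\<^sub>R (\<Sum>y<N. u y)"

lemma av_add: "av N (\<lambda>y. u y + v y) = av N u + av N v"
  by (simp add: av_def sum.distrib scaleR_add_right)

lemma av_diff: "av N (\<lambda>y. u y - v y) = av N u - av N v"
  by (simp add: av_def sum_subtractf scaleR_diff_right)

lemma av_scale: "av N (\<lambda>y. c *\<^sub>R u y) = c *\<^sub>R av N u"
  by (simp add: av_def scaleR_sum_right[symmetric])

lemma av_sum: "av N (\<lambda>y. \<Sum>i\<in>I. u i y) = (\<Sum>i\<in>I. av N (u i))"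
  by (simp add: av_def scaleR_sum_right) (rule sum.swap)

lemma av_Suc: "av (Suc N) u = (1 - 1 / real (Suc N)) *\<^sub>R av N u + (1 / real (Suc N)) *\<^sub>R u N"
proof (cases "N = 0")
  case False
  then have "(1 - 1 / real (Suc N)) * (1 / real N) = 1 / real (Suc N)"
    by (simp add: field_simps)
  then show ?thesis
    by (simp add: av_def scaleR_add_right)
qed (simp add: av_def)

lemma av_mono:
  fixes u v :: "nat \<Rightarrow> real"
  assumes "\<And>y. y < N \<Longrightarrow> u y \<le> v y"
  shows "av N u \<le> av N v"
  using assms by (auto simp: av_def intro!: divide_right_mono sum_mono)

lemma av_const: "N > 0 \<Longrightarrow> av N (\<lambda>y. c) = (c::real)"
  by (simp add: av_def)

text \<open>Writing \<open>p = pCons c q\<close>, the difference for \<open>p\<close> is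
  \<open>[:a, 1:]\<close> times the difference for \<open>q\<close> plus \<open>(b - a)\<close>
  times a shift of \<open>q\<close>. The assumption is a bound rather than an equality because
  \<open>q\<close> only inherits a bound in the induction.\<close>

lemma degree_pcompose_shift_diff:
  fixes p :: "'a :: idom poly"
  assumes "degree p \<le> Suc n"
  shows "degree (pcompose p [:b, 1:] - pcompose p [:a, 1:]) \<le> n \<and>
    coeff (pcompose p [:b, 1:] - pcompose p [:a, 1:]) n = of_nat (Suc n) * (b - a) * coeff p (Suc n)"
  using assms
proof (induction n arbitrary: p)
  case 0
  obtain t q where p: "p = pCons t q" by (cases p)
  moreover obtain s where "q = [:s:]"
    using 0 p by (cases q rule: pCons_cases) (auto split: if_splits)
  ultimately have "p = [:t, s:]" by simp
  then show ?case
    by (simp add: pcompose_pCons right_diff_distrib mult.commute)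
next
  case (Suc n)
  obtain c q where p: "p = pCons c q" by (cases p)
  have q: "degree q \<le> Suc n" using Suc.prems p by (auto split: if_splits)
  define D where "D = pcompose q [:b, 1:] - pcompose q [:a, 1:]"
  have D: "degree D \<le> n" "coeff D n = of_nat (Suc n) * (b - a) * coeff q (Suc n)"
    using Suc.IH[OF q] by (auto simp: D_def)
  define qb where "qb = pcompose q [:b, 1:]"
  have qb: "degree qb \<le> Suc n"
    using q by (simp add: qb_def degree_pcompose)
  have cqb: "coeff qb (Suc n) = coeff q (Suc n)"
  proof (cases "degree q = Suc n")
    case True
    then show ?thesis
      using lead_coeff_comp[of "[:b, 1:]" q] by (simp add: qb_def degree_pcompose)
  next
    case False
    then have "degree q < Suc n" using q by simp
    then show ?thesis
      by (simp add: qb_def coeff_eq_0 degree_pcompose)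
  qed
  have E: "pcompose p [:b, 1:] - pcompose p [:a, 1:] = [:a, 1:] * D + smult (b - a) qb"
    by (simp add: p pcompose_pCons D_def qb_def algebra_simps smult_diff_left)
  have "degree ([:a, 1:] * D) \<le> Suc n"
    using D(1) degree_mult_le[of "[:a, 1:]" D] by simp
  moreover have "degree (smult (b - a) qb) \<le> Suc n"
    using qb degree_smult_le le_trans by blast
  ultimately have "degree ([:a, 1:] * D + smult (b - a) qb) \<le> Suc n"
    by (rule degree_add_le)
  moreover have "coeff D (Suc n) = 0"
    using D(1) by (simp add: coeff_eq_0)
  then have "coeff ([:a, 1:] * D + smult (b - a) qb) (Suc n) = coeff D n + (b - a) * coeff q (Suc n)"
    using cqb by (simp add: coeff_pCons)
  ultimately show ?case
    unfolding E by (simp add: D(2) p algebra_simps)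
qed

text \<open>For a nonzero shift the coefficient computed above does not vanish over the integers.
  The exact degree, not a mere bound, is what each van der Corput step hands on to the
  induction.\<close>

lemma degree_shift_diff:
  fixes p :: "int poly"
  assumes "degree p = Suc n" "a \<noteq> b"
  shows "degree (pcompose p [:b, 1:] - pcompose p [:a, 1:]) = n"
proof -
  have "coeff p (Suc n) \<noteq> 0"
    using assms(1) by (metis leading_coeff_0_iff degree_0 nat.distinct(1))
  then have "coeff (pcompose p [:b, 1:] - pcompose p [:a, 1:]) n \<noteq> 0"
    using degree_pcompose_shift_diff[of p n b a] assms by simp
  then show ?thesis
    using degree_pcompose_shift_diff[of p n b a] assms(1) le_antisym le_degree by (metis order_refl)
qed

subsection \<open>Isometric actions of the plane lattice\<close>

text \<open>The form is only semidefinite and completeness is not assumed. Null vectors are not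
  factored out, and minimisers, projections and limits are replaced below by approximate versions
  with explicit errors.\<close>

locale isometric_action =
  fixes ip :: "'a::real_vector \<Rightarrow> 'a \<Rightarrow> real"
    and T :: "int \<times> int \<Rightarrow> 'a \<Rightarrow> 'a"
  assumes ip_commute: "ip x y = ip y x"
    and ip_add_left: "ip (x + y) z = ip x z + ip y z"
    and ip_scale_left: "ip (c *\<^sub>R x) z = c * ip x z"
    and ip_nonneg: "ip x x \<ge> 0"
    and T_add: "T v (x + y) = T v x + T v y"
    and T_scale: "T v (c *\<^sub>R x) = c *\<^sub>R T v x"
    and T_plus: "T (u + v) x = T u (T v x)"
    and T_zero: "T 0 x = x"
    and ip_T: "ip (T v x) (T v y) = ip x y"
begin

lemma ip_add_right: "ip x (y + z) = ip x y + ip x z"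
  by (metis ip_commute ip_add_left)

lemma ip_scale_right: "ip x (c *\<^sub>R y) = c * ip x y"
  by (metis ip_commute ip_scale_left)

lemma ip_diff_left: "ip (x - y) z = ip x z - ip y z"
  using ip_add_left[of "x - y" y z] by simp

lemma ip_diff_right: "ip x (y - z) = ip x y - ip x z"
  by (metis ip_commute ip_diff_left)

lemma ip_zero_left: "ip 0 x = 0"
  using ip_scale_left[of 0 0 x] by simp

lemma ip_zero_right: "ip x 0 = 0"
  by (metis ip_commute ip_zero_left)

lemma ip_sum_left: "ip (sum u I) x = (\<Sum>i\<in>I. ip (u i) x)"
  by (induction I rule: infinite_finite_induct) (simp_all add: ip_zero_left ip_add_left)

lemma ip_sum_right: "ip x (sum u I) = (\<Sum>i\<in>I. ip x (u i))"
  by (induction I rule: infinite_finite_induct) (simp_all add: ip_zero_right ip_add_right)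

lemma ip_av_right: "ip x (av N u) = av N (\<lambda>y. ip x (u y))"
  by (simp add: av_def ip_scale_right ip_sum_right)

lemma T_diff: "T v (x - y) = T v x - T v y"
  using T_add[of v "x - y" y] by (simp add: algebra_simps)

lemma T_zero_right: "T v 0 = 0"
  using T_diff[of v 0 0] by simp

lemma T_sum: "T v (sum u I) = (\<Sum>i\<in>I. T v (u i))"
  by (induction I rule: infinite_finite_induct) (simp_all add: T_zero_right T_add)

lemma T_av: "T v (av N u) = av N (\<lambda>y. T v (u y))"
  by (simp add: av_def T_scale T_sum)

lemma T_T: "T u (T v x) = T (u + v) x"
  by (simp add: T_plus)

lemma ip_T_T: "ip (T u x) (T v y) = ip x (T (v - u) y)"
  using ip_T[of u x "T (v - u) y"] by (simp add: T_T)

section \<open>The seminorm of the form\<close>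

definition nrm :: "'a \<Rightarrow> real" where "nrm x = sqrt (ip x x)"

lemma nrm_nonneg [simp]: "nrm x \<ge> 0"
  by (simp add: nrm_def ip_nonneg)

lemma nrm_square: "nrm x ^ 2 = ip x x"
  by (simp add: nrm_def ip_nonneg)

lemma nrm_T [simp]: "nrm (T v x) = nrm x"
  by (simp add: nrm_def ip_T)

lemma nrm_zero [simp]: "nrm 0 = 0"
  by (simp add: nrm_def ip_zero_left)

lemma nrm_scale: "nrm (c *\<^sub>R x) = \<bar>c\<bar> * nrm x"
  by (simp add: nrm_def ip_scale_left ip_scale_right real_sqrt_mult flip: mult.assoc)

text \<open>Cauchy-Schwarz, from nonnegativity of the quadratic
  \<open>ip (x - t *\<^sub>R y) (x - t *\<^sub>R y)\<close> in \<open>t\<close>. As the form is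
  semidefinite, the degenerate case \<open>ip y y = 0\<close> needs its own argument.\<close>

lemma ip_square_le: "(ip x y)\<^sup>2 \<le> ip x x * ip y y"
proof -
  have P: "0 \<le> ip x x - 2 * t * ip x y + t\<^sup>2 * ip y y" for t
    using ip_nonneg[of "x - t *\<^sub>R y"] ip_commute[of y x]
    by (simp add: ip_diff_left ip_diff_right ip_scale_left ip_scale_right power2_eq_square algebra_simps)
  show ?thesis
  proof (cases "ip y y = 0")
    case True
    have "ip x y = 0"
    proof (rule ccontr)
      assume "ip x y \<noteq> 0"
      then show False
        \<comment> \<open>This \<open>t\<close> turns the expression, now linear in
          \<open>t\<close>, into \<open>-1\<close>.\<close>
        using P[of "(ip x x + 1) / (2 * ip x y)"] True by simp
    qed
    then show ?thesis using True by simp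
  next
    case False
    then have pos: "ip y y > 0" using ip_nonneg[of y] by simp
    have "0 \<le> (ip x x - 2 * (ip x y / ip y y) * ip x y + (ip x y / ip y y)\<^sup>2 * ip y y) * ip y y"
      using P[of "ip x y / ip y y"] pos by (intro mult_nonneg_nonneg) auto
    also have "\<dots> = ip x x * ip y y - (ip x y)\<^sup>2"
      using pos by (simp add: field_simps power2_eq_square)
    finally show ?thesis by simp
  qed
qed

lemma abs_ip_le: "\<bar>ip x y\<bar> \<le> nrm x * nrm y"
proof -
  have "sqrt ((ip x y)\<^sup>2) \<le> sqrt (ip x x * ip y y)"
    using ip_square_le by (rule real_sqrt_le_mono)
  then show ?thesis by (simp add: nrm_def real_sqrt_mult)
qed

lemma nrm_triangle: "nrm (x + y) \<le> nrm x + nrm y"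
proof (rule power2_le_imp_le)
  have "(nrm (x + y))\<^sup>2 = ip x x + 2 * ip x y + ip y y"
    by (simp add: nrm_square ip_add_left ip_add_right ip_commute[of y x])
  also have "\<dots> \<le> (nrm x + nrm y)\<^sup>2"
    using abs_ip_le[of x y] by (simp add: power2_sum nrm_square)
  finally show "(nrm (x + y))\<^sup>2 \<le> (nrm x + nrm y)\<^sup>2" .
qed simp

lemma nrm_minus_commute: "nrm (x - y) = nrm (y - x)"
  using nrm_scale[of "-1" "x - y"] by simp

lemma nrm_triangle_diff: "nrm (x - y) \<le> nrm x + nrm y"
  using nrm_triangle[of x "- 1 *\<^sub>R y"] nrm_scale[of "-1" y] by simp

lemma nrm_triangle_via: "nrm (x - z) \<le> nrm (x - y) + nrm (y - z)"
  using nrm_triangle[of "x - y" "y - z"] by simp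

lemma nrm_sum: "nrm (sum u I) \<le> (\<Sum>i\<in>I. nrm (u i))"
proof (induction I rule: infinite_finite_induct)
  case (insert i I)
  then show ?case
    using nrm_triangle[of "u i" "sum u I"] by simp
qed simp_all

lemma nrm_av: "nrm (av N u) \<le> av N (\<lambda>y. nrm (u y))"
  using nrm_sum[of u "{..<N}"] by (simp add: av_def nrm_scale divide_right_mono)

lemma nrm_av_le:
  assumes "\<And>y. nrm (u y) \<le> K"
  shows "nrm (av N u) \<le> K"
proof (cases "N = 0")
  case True
  then show ?thesis using order_trans[OF nrm_nonneg assms] by (simp add: av_def)
next
  case False
  have "nrm (av N u) \<le> av N (\<lambda>y. K)"
    by (rule order_trans[OF nrm_av av_mono]) (rule assms)
  then show ?thesis using False by (simp add: av_const)
qed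

section \<open>Van der Corput's inequality and polynomial averages\<close>

lemma nrm_av_square_le: "(nrm (av N u))\<^sup>2 \<le> av N (\<lambda>y. (nrm (u y))\<^sup>2)"
proof (cases "N = 0")
  case False
  have "(nrm (av N u))\<^sup>2 \<le> (av N (\<lambda>y. nrm (u y)))\<^sup>2"
    by (rule power_mono[OF nrm_av]) simp
  also have "\<dots> \<le> (real N * (\<Sum>y<N. (nrm (u y))\<^sup>2)) / (real N)\<^sup>2"
    using sum_squared_le_sum_of_squares[of "\<lambda>y. nrm (u y)" "{..<N}"]
    by (simp add: av_def power_divide divide_right_mono mult.commute)
  also have "\<dots> = av N (\<lambda>y. (nrm (u y))\<^sup>2)"
    using False by (simp add: av_def field_simps power2_eq_square)
  finally show ?thesis .
qed (simp add: av_def)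

text \<open>A shift by one exchanges a single one of the \<open>N\<close> summands and so costs at
  most \<open>2 * K / real N\<close>; this is repeated \<open>h\<close> times.\<close>

lemma nrm_av_shift:
  assumes "\<And>y. nrm (u y) \<le> K"
  shows "nrm (av N (\<lambda>y. u (y + h)) - av N u) \<le> 2 * real h * K / real N"
proof (induction h)
  case (Suc h)
  have "(\<Sum>y<N. u (y + Suc h)) - (\<Sum>y<N. u (y + h)) = u (N + h) - u h"
    using sum_lessThan_telescope[of "\<lambda>y. u (y + h)" N] by (simp add: sum_subtractf)
  then have "av N (\<lambda>y. u (y + Suc h)) - av N (\<lambda>y. u (y + h)) = (1 / real N) *\<^sub>R (u (N + h) - u h)"
    by (simp add: av_def flip: scaleR_diff_right)
  moreover have "nrm (u (N + h) - u h) \<le> 2 * K"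
    using nrm_triangle_diff[of "u (N + h)" "u h"] assms[of "N + h"] assms[of h] by simp
  ultimately have "nrm (av N (\<lambda>y. u (y + Suc h)) - av N (\<lambda>y. u (y + h))) \<le> 2 * K / real N"
    by (simp add: nrm_scale divide_right_mono)
  then show ?case
    using Suc.IH nrm_triangle_via[of "av N (\<lambda>y. u (y + Suc h))" "av N u" "av N (\<lambda>y. u (y + h))"]
    by (simp add: algebra_simps add_divide_distrib)
qed simp

text \<open>For large \<open>N\<close> the average of \<open>u\<close> is close to the average of
  its window means \<open>w\<close> of length \<open>H\<close>. By convexity the squared norm of the
  latter is at most the mean correlation over all pairs \<open>h\<close>, \<open>h'\<close>: the
  diagonal contributes \<open>K\<^sup>2 / real H\<close>, the other pairs at most
  \<open>\<gamma>\<close>.\<close>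

lemma van_der_Corput:
  assumes u: "\<And>y. nrm (u y) \<le> K" and H: "H > 0" and "e > 0"
    and c: "K\<^sup>2 / real H + \<gamma> \<le> (e / 2)\<^sup>2" "\<gamma> \<ge> 0"
    and corr: "\<And>h h'. h < H \<Longrightarrow> h' < H \<Longrightarrow> h \<noteq> h' \<Longrightarrow>
      \<forall>\<^sub>F N in sequentially. av N (\<lambda>y. ip (u (y + h)) (u (y + h'))) \<le> \<gamma>"
  shows "\<forall>\<^sub>F N in sequentially. nrm (av N u) \<le> e"
proof -
  have K: "K \<ge> 0" using order_trans[OF nrm_nonneg u] .
  define w where "w y = av H (\<lambda>h. u (y + h))" for y
  have avw: "av N w = av H (\<lambda>h. av N (\<lambda>y. u (y + h)))" for N
    by (simp add: w_def av_def scaleR_sum_right mult.commute) (rule sum.swap)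
  have diff: "nrm (av N w - av N u) \<le> 2 * real H * K / real N" for N
  proof -
    have "av N w - av N u = av H (\<lambda>h. av N (\<lambda>y. u (y + h)) - av N u)"
      using H by (simp add: avw av_diff) (simp add: av_def sum_constant_scaleR)
    also have "nrm \<dots> \<le> av H (\<lambda>h. nrm (av N (\<lambda>y. u (y + h)) - av N u))"
      by (rule nrm_av)
    also have "\<dots> \<le> av H (\<lambda>h. 2 * real H * K / real N)"
    proof (rule av_mono)
      fix h assume "h < H"
      then have "2 * real h * K / real N \<le> 2 * real H * K / real N"
        using K by (intro divide_right_mono mult_right_mono) auto
      then show "nrm (av N (\<lambda>y. u (y + h)) - av N u) \<le> 2 * real H * K / real N"
        using nrm_av_shift[of u K N h] u by (meson order_trans)
    qed
    finally show ?thesis using H by (simp add: av_const)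
  qed
  have w2: "av N (\<lambda>y. (nrm (w y))\<^sup>2) =
      av H (\<lambda>h. av H (\<lambda>h'. av N (\<lambda>y. ip (u (y + h)) (u (y + h')))))" for N
  proof -
    have "(nrm (w y))\<^sup>2 = (1 / real H)\<^sup>2 * (\<Sum>h<H. \<Sum>h'<H. ip (u (y + h)) (u (y + h')))" for y
      unfolding nrm_square
      by (simp add: w_def av_def ip_scale_left ip_scale_right ip_sum_left ip_sum_right power2_eq_square
          flip: sum_divide_distrib) (auto intro: sum.swap)
    then have "av N (\<lambda>y. (nrm (w y))\<^sup>2) =
        (1 / real H)\<^sup>2 * av N (\<lambda>y. \<Sum>h<H. \<Sum>h'<H. ip (u (y + h)) (u (y + h')))"
      using av_scale[where 'a = real] by simp
    then show ?thesis
      by (simp add: av_sum) (simp add: av_def sum_divide_distrib power2_eq_square mult.assoc)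
  qed
  \<comment> \<open>There are only finitely many pairs, so one threshold for \<open>N\<close> serves
    them all.\<close>
  have corr': "\<forall>\<^sub>F N in sequentially. \<forall>h\<in>{..<H}. \<forall>h'\<in>{..<H}. h \<noteq> h' \<longrightarrow>
      av N (\<lambda>y. ip (u (y + h)) (u (y + h'))) \<le> \<gamma>"
    by (intro eventually_ball_finite ballI) (use corr in auto)
  have "(\<lambda>N. 2 * real H * K / real N) \<longlonglongrightarrow> 0"
    by (rule lim_const_over_n)
  then have small: "\<forall>\<^sub>F N in sequentially. 2 * real H * K / real N < e / 2"
    by (rule order_tendstoD) (use \<open>e > 0\<close> in simp)
  show ?thesis
    using corr' small eventually_gt_at_top[of 0]
  proof eventually_elim
    case (elim N)
    have "av N (\<lambda>y. ip (u (y + h)) (u (y + h'))) \<le> (if h = h' then K\<^sup>2 else 0) + \<gamma>"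
      if "h < H" "h' < H" for h h'
    proof (cases "h = h'")
      case True
      have "av N (\<lambda>y. ip (u (y + h)) (u (y + h))) \<le> av N (\<lambda>y. K\<^sup>2)"
        unfolding nrm_square[symmetric] by (intro av_mono power_mono u) auto
      then show ?thesis using True elim c(2) by (simp add: av_const)
    next
      case False
      then show ?thesis using elim that by auto
    qed
    then have "av N (\<lambda>y. (nrm (w y))\<^sup>2) \<le> av H (\<lambda>h. av H (\<lambda>h'. (if h = h' then K\<^sup>2 else 0) + \<gamma>))"
      unfolding w2 by (intro av_mono) auto
    also have "\<dots> = av H (\<lambda>h. K\<^sup>2 / real H + \<gamma>)"
      unfolding av_def using H by (intro arg_cong2[of _ _ _ _ scaleR] sum.cong) (auto simp: sum.distrib field_simps)
    also have "\<dots> = K\<^sup>2 / real H + \<gamma>"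
      using H by (simp add: av_const)
    finally have "(nrm (av N w))\<^sup>2 \<le> (e / 2)\<^sup>2"
      using nrm_av_square_le[of N w] c(1) by linarith
    then have "nrm (av N w) \<le> e / 2"
      by (rule power2_le_imp_le) (use \<open>e > 0\<close> in simp)
    then show ?case
      using diff[of N] elim nrm_triangle_diff[of "av N w" "av N w - av N u"] by simp
  qed
qed

text \<open>
  The proof is by induction on the degree: differencing kills the linear second coordinate and lowers the
  degree of the first one, until an average along an arithmetic progression with step \<open>(s, 0)\<close> remains.
  The bound \<open>\<epsilon>\<close> must not depend on \<open>m\<close>, which is chosen in terms of \<open>\<epsilon>\<close> later.
\<close>

lemma polynomial_averages_small:
  assumes "e > 0" "K \<ge> 0"
  shows "\<exists>\<epsilon>>0. \<forall>g m p a b. nrm g \<le> K \<longrightarrow> degree p = Suc n \<longrightarrow> (n = 0 \<longrightarrow> a = 0) \<longrightarrow>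
    (\<forall>y. m dvd poly p y) \<longrightarrow>
    (\<forall>s. s \<noteq> 0 \<longrightarrow> m dvd s \<longrightarrow> (\<forall>\<^sub>F N in sequentially. nrm (av N (\<lambda>y. T (s * int y, 0) g)) \<le> \<epsilon>)) \<longrightarrow>
    (\<forall>\<^sub>F N in sequentially. nrm (av N (\<lambda>y. T (poly p (int y), a * int y + b) g)) \<le> e)"
  using assms(1)
proof (induction n arbitrary: e)
  case 0
  show ?case
  proof (intro exI[of _ e] conjI allI impI)
    fix g m p a b
    assume p: "degree p = Suc 0" and a: "(0::nat) = 0 \<longrightarrow> a = (0::int)"
      and m: "\<forall>y. m dvd poly p y"
      and s: "\<forall>s. s \<noteq> 0 \<longrightarrow> m dvd s \<longrightarrow> (\<forall>\<^sub>F N in sequentially. nrm (av N (\<lambda>y. T (s * int y, 0) g)) \<le> e)"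
    obtain s t where st: "p = [:t, s:]" "s \<noteq> 0"
      using p by (metis degree1_coeffs One_nat_def)
    \<comment> \<open>As \<open>a = 0\<close> here, the path is an arithmetic progression in the
      first coordinate up to the fixed translation \<open>(t, b)\<close>. Its step \<open>s\<close>
      is a difference of values of \<open>p\<close>, so the hypothesis on multiples of
      \<open>m\<close> applies.\<close>
    have "m dvd poly p 1 - poly p 0" using m by (simp only: dvd_diff)
    then have "m dvd s" by (simp add: st)
    have "T (poly p (int y), a * int y + b) g = T (t, b) (T (s * int y, 0) g)" for y
      using a by (simp add: T_T st mult.commute)
    then have "nrm (av N (\<lambda>y. T (poly p (int y), a * int y + b) g)) = nrm (av N (\<lambda>y. T (s * int y, 0) g))" for N
      by (simp flip: T_av)
    then show "\<forall>\<^sub>F N in sequentially. nrm (av N (\<lambda>y. T (poly p (int y), a * int y + b) g)) \<le> e"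
      using s st(2) \<open>m dvd s\<close> by simp
  qed (rule 0)
next
  case (Suc n)
  \<comment> \<open>Then \<open>(e / 2)\<^sup>2 = 2 * \<gamma>\<close>: one \<open>\<gamma>\<close>
    pays for the diagonal, the other for the remaining pairs.\<close>
  define \<gamma> where "\<gamma> = e\<^sup>2 / 8"
  have \<gamma>: "\<gamma> > 0" using Suc.prems by (simp add: \<gamma>_def)
  obtain H :: nat where H: "H > 0" "K\<^sup>2 / real H \<le> \<gamma>"
  proof -
    obtain H :: nat where "K\<^sup>2 / \<gamma> < real H" using reals_Archimedean2 by blast
    then have "K\<^sup>2 / real (Suc H) \<le> \<gamma>"
      using \<gamma> by (simp add: field_simps)
    then show ?thesis using that[of "Suc H"] by simp
  qed
  \<comment> \<open>\<open>K + 1\<close> instead of \<open>K\<close> covers the case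
    \<open>K = 0\<close>.\<close>
  have "\<gamma> / (K + 1) > 0" using \<gamma> assms(2) by simp
  from Suc.IH[OF this] obtain \<epsilon> where "\<epsilon> > 0" and \<epsilon>: "\<And>g m p a b. nrm g \<le> K \<Longrightarrow> degree p = Suc n \<Longrightarrow>
    (n = 0 \<longrightarrow> a = 0) \<Longrightarrow> (\<forall>y. m dvd poly p y) \<Longrightarrow>
    (\<forall>s. s \<noteq> 0 \<longrightarrow> m dvd s \<longrightarrow> (\<forall>\<^sub>F N in sequentially. nrm (av N (\<lambda>y. T (s * int y, 0) g)) \<le> \<epsilon>)) \<Longrightarrow>
    (\<forall>\<^sub>F N in sequentially. nrm (av N (\<lambda>y. T (poly p (int y), a * int y + b) g)) \<le> \<gamma> / (K + 1))"
    by blast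
  show ?case
  proof (intro exI[of _ \<epsilon>] conjI allI impI)
    fix g m p and a b :: int
    assume g: "nrm g \<le> K" and p: "degree p = Suc (Suc n)" and m: "\<forall>y. m dvd poly p y"
      and s: "\<forall>s. s \<noteq> 0 \<longrightarrow> m dvd s \<longrightarrow> (\<forall>\<^sub>F N in sequentially. nrm (av N (\<lambda>y. T (s * int y, 0) g)) \<le> \<epsilon>)"
    show "\<forall>\<^sub>F N in sequentially. nrm (av N (\<lambda>y. T (poly p (int y), a * int y + b) g)) \<le> e"
    proof (rule van_der_Corput[where K = K and H = H and \<gamma> = \<gamma>])
      show "K\<^sup>2 / real H + \<gamma> \<le> (e / 2)\<^sup>2"
      proof -
        have "(e / 2)\<^sup>2 = 2 * \<gamma>" by (simp add: \<gamma>_def power2_eq_square)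
        then show ?thesis using H(2) by linarith
      qed
      fix h h' assume "h < H" "h' < H" and hh: "h \<noteq> (h'::nat)"
      define q where "q = pcompose p [:int h', 1:] - pcompose p [:int h, 1:]"
      have q: "degree q = Suc n"
        unfolding q_def using degree_shift_diff[OF p, of "int h" "int h'"] hh by simp
      have mq: "\<forall>y. m dvd poly q y"
        using m by (simp add: q_def poly_pcompose)
      \<comment> \<open>The differenced path has constant second coordinate, so the induction
        hypothesis is applied with slope \<open>0\<close>, as it demands when
        \<open>n = 0\<close>.\<close>
      have "\<forall>\<^sub>F N in sequentially. nrm (av N (\<lambda>y. T (poly q (int y), 0 * int y + a * (int h' - int h)) g)) \<le> \<gamma> / (K + 1)"
        by (rule \<epsilon>[OF g q _ mq s]) simp
      then show "\<forall>\<^sub>F N in sequentially. av N (\<lambda>y. ip (T (poly p (int (y + h)), a * int (y + h) + b) g)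
             (T (poly p (int (y + h')), a * int (y + h') + b) g)) \<le> \<gamma>"
      proof eventually_elim
        case (elim N)
        have "ip (T (poly p (int (y + h)), a * int (y + h) + b) g)
             (T (poly p (int (y + h')), a * int (y + h') + b) g)
            = ip g (T (poly q (int y), a * (int h' - int h)) g)" for y
          by (simp add: ip_T_T q_def poly_pcompose algebra_simps)
        then have "av N (\<lambda>y. ip (T (poly p (int (y + h)), a * int (y + h) + b) g)
             (T (poly p (int (y + h')), a * int (y + h') + b) g)) =
            ip g (av N (\<lambda>y. T (poly q (int y), a * (int h' - int h)) g))" (is "?l = ip g ?r")
          by (simp add: ip_av_right)
        also have "\<dots> \<le> nrm g * nrm ?r"
          using abs_ip_le[of g ?r] by simp
        also have "\<dots> \<le> K * (\<gamma> / (K + 1))"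
          using elim by (intro mult_mono g assms(2)) auto
        also have "\<dots> \<le> \<gamma>"
          using \<gamma> assms(2) by (simp add: field_simps)
        finally show ?case .
      qed
    qed (use g H \<gamma> Suc.prems in auto)
  qed (rule \<open>\<epsilon> > 0\<close>)
qed

subsection \<open>Splitting off the almost rational part\<close>

text \<open>The convex hull of the translates of \<open>f\<close> by multiples of
  \<open>(m, 0)\<close>, without closure. The inductive form lets each property of it be proved by
  checking translations and two-term convex combinations only.\<close>

inductive_set orbit_hull :: "int \<Rightarrow> 'a \<Rightarrow> 'a set" for m f where
  base: "f \<in> orbit_hull m f"
| shift: "g \<in> orbit_hull m f \<Longrightarrow> T (m * j, 0) g \<in> orbit_hull m f"
| convex: "g \<in> orbit_hull m f \<Longrightarrow> h \<in> orbit_hull m f \<Longrightarrow> 0 \<le> t \<Longrightarrow> t \<le> 1 \<Longrightarrow>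
    (1 - t) *\<^sub>R g + t *\<^sub>R h \<in> orbit_hull m f"

lemma orbit_hull_shift_dvd: "g \<in> orbit_hull m f \<Longrightarrow> m dvd s \<Longrightarrow> T (s, 0) g \<in> orbit_hull m f"
  by (auto simp: dvd_def intro: orbit_hull.shift)

lemma orbit_hull_subset: "g \<in> orbit_hull m' f \<Longrightarrow> m dvd m' \<Longrightarrow> g \<in> orbit_hull m f"
  by (induction rule: orbit_hull.induct) (auto intro: orbit_hull.intros orbit_hull_shift_dvd)

lemma orbit_hull_av:
  assumes "\<And>y. u y \<in> orbit_hull m f" "N > 0"
  shows "av N u \<in> orbit_hull m f"
  using assms(2)
proof (induction N)
  case (Suc N)
  show ?case
  proof (cases "N = 0")
    case True
    then show ?thesis using assms(1) by (simp add: av_def)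
  next
    case False
    then show ?thesis
      unfolding av_Suc using Suc assms(1) by (intro orbit_hull.convex) auto
  qed
qed simp

lemma orbit_hull_nrm_le: "g \<in> orbit_hull m f \<Longrightarrow> nrm g \<le> nrm f"
proof (induction rule: orbit_hull.induct)
  case (convex g h t)
  have "nrm ((1 - t) *\<^sub>R g + t *\<^sub>R h) \<le> (1 - t) * nrm g + t * nrm h"
    using nrm_triangle[of "(1 - t) *\<^sub>R g" "t *\<^sub>R h"] convex by (simp add: nrm_scale)
  also have "\<dots> \<le> nrm f"
    using convex by (intro convex_bound_le) auto
  finally show ?case .
qed simp_all

text \<open>Ensures that the almost rational part of \<open>f\<close> keeps the mean of
  \<open>f\<close>.\<close>

lemma ip_orbit_hull_invariant:
  assumes "g \<in> orbit_hull m f" "\<And>v. T v one = one"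
  shows "ip g one = ip f one"
  using assms(1)
proof (induction rule: orbit_hull.induct)
  case (shift g j)
  then show ?case using ip_T[of "(m * j, 0)" g one] assms(2) by simp
qed (simp_all add: ip_add_left ip_scale_left left_diff_distrib)

text \<open>A translation of \<open>g\<close> can be moved onto \<open>w\<close>, where it is nearly
  invisible, and convex combinations do not enlarge the error. The bound must be proved for all
  \<open>j\<close> at once, since the shift case uses it at \<open>j - i\<close>.\<close>

lemma ip_orbit_hull_almost_invariant:
  assumes "g \<in> orbit_hull m f" and w: "\<And>j. nrm (T (m * j, 0) w - w) \<le> \<epsilon>"
  shows "\<bar>ip g (T (m * j, 0) w) - ip f w\<bar> \<le> nrm f * \<epsilon>"
  using assms(1)
proof (induction arbitrary: j rule: orbit_hull.induct)
  case base
  have "\<bar>ip f (T (m * j, 0) w) - ip f w\<bar> \<le> nrm f * nrm (T (m * j, 0) w - w)"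
    using abs_ip_le[of f "T (m * j, 0) w - w"] by (simp add: ip_diff_right)
  also have "\<dots> \<le> nrm f * \<epsilon>"
    by (intro mult_left_mono w) simp
  finally show ?case .
next
  case (shift g i)
  then show ?case using shift.IH[of "j - i"] by (simp add: ip_T_T algebra_simps)
next
  case (convex g h t)
  have "ip ((1 - t) *\<^sub>R g + t *\<^sub>R h) (T (m * j, 0) w) - ip f w =
      (1 - t) * (ip g (T (m * j, 0) w) - ip f w) + t * (ip h (T (m * j, 0) w) - ip f w)"
    by (simp add: ip_add_left ip_scale_left left_diff_distrib right_diff_distrib)
  also have "\<bar>\<dots>\<bar> \<le> (1 - t) * \<bar>ip g (T (m * j, 0) w) - ip f w\<bar> + t * \<bar>ip h (T (m * j, 0) w) - ip f w\<bar>"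
    using convex.hyps by (intro order_trans[OF abs_triangle_ineq]) (simp add: abs_mult)
  also have "\<dots> \<le> nrm f * \<epsilon>"
    using convex by (intro convex_bound_le) auto
  finally show ?case .
qed

text \<open>A translation by \<open>(s * j, 0)\<close> changes the averages only by boundary terms,
  and averaging is linear. So passing to the hull does not affect the asymptotic averages.\<close>

lemma orbit_hull_av_asymptotic:
  assumes "g \<in> orbit_hull s f" "e > 0"
  shows "\<forall>\<^sub>F N in sequentially.
    nrm (av N (\<lambda>y. T (s * int y, 0) g) - av N (\<lambda>y. T (s * int y, 0) f)) \<le> e"
  using assms
proof (induction arbitrary: e rule: orbit_hull.induct)
  case base
  then show ?case by simp
next
  case (shift g j)
  define A where "A h N = av N (\<lambda>y. T (s * int y, 0) h)" for h N
  define i where "i = nat \<bar>j\<bar>"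
  have step: "nrm (A (T (s * int i, 0) g) N - A g N) \<le> 2 * real i * nrm g / real N" for N
    using nrm_av_shift[of "\<lambda>y. T (s * int y, 0) g" "nrm g" N i]
    by (simp add: A_def T_T algebra_simps)
  have step': "nrm (A (T (s * j, 0) g) N - A g N) \<le> 2 * real i * nrm g / real N" for N
  proof (cases "j \<ge> 0")
    case True
    then show ?thesis using step by (simp add: i_def)
  next
    case False
    then have j: "j = - int i" by (simp add: i_def)
    \<comment> \<open>For negative \<open>j\<close>, translating back by the isometry reduces to the
      forward shift by \<open>i\<close>.\<close>
    have "T (s * int i, 0) (A (T (s * j, 0) g) N - A g N) = A g N - A (T (s * int i, 0) g) N"
      by (simp add: A_def T_diff T_av T_T j algebra_simps)
    then have "nrm (A (T (s * j, 0) g) N - A g N) = nrm (A (T (s * int i, 0) g) N - A g N)"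
      by (metis nrm_T nrm_minus_commute)
    then show ?thesis using step by simp
  qed
  have "(\<lambda>N. 2 * real i * nrm g / real N) \<longlonglongrightarrow> 0"
    by (rule lim_const_over_n)
  then have "\<forall>\<^sub>F N in sequentially. 2 * real i * nrm g / real N < e / 2"
    by (rule order_tendstoD) (use \<open>e > 0\<close> in simp)
  moreover have "\<forall>\<^sub>F N in sequentially. nrm (A g N - A f N) \<le> e / 2"
    unfolding A_def by (rule shift.IH) (use \<open>e > 0\<close> in simp)
  ultimately show ?case
    unfolding A_def[symmetric]
  proof eventually_elim
    case (elim N)
    then show ?case
      using step'[of N] nrm_triangle_via[of "A (T (s * j, 0) g) N" "A f N" "A g N"] by simp
  qed
next
  case (convex g h t)
  define A where "A h N = av N (\<lambda>y. T (s * int y, 0) h)" for h N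
  have "\<forall>\<^sub>F N in sequentially. nrm (A g N - A f N) \<le> e" "\<forall>\<^sub>F N in sequentially. nrm (A h N - A f N) \<le> e"
    unfolding A_def using convex by auto
  then show ?case
    unfolding A_def[symmetric]
  proof eventually_elim
    case (elim N)
    have "A ((1 - t) *\<^sub>R g + t *\<^sub>R h) N - A f N = (1 - t) *\<^sub>R (A g N - A f N) + t *\<^sub>R (A h N - A f N)"
      by (simp add: A_def T_add T_scale av_add av_scale) (simp add: algebra_simps)
    also have "nrm \<dots> \<le> (1 - t) * nrm (A g N - A f N) + t * nrm (A h N - A f N)"
      using nrm_triangle[of "(1 - t) *\<^sub>R (A g N - A f N)" "t *\<^sub>R (A h N - A f N)"] convex
      by (simp add: nrm_scale)
    also have "\<dots> \<le> e"
      using elim convex by (intro convex_bound_le) auto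
    finally show ?case .
  qed
qed

text \<open>The parallelogram law: the midpoint of \<open>a\<close> and \<open>b\<close> lies in the
  hull, so its squared norm is at least \<open>c\<close>. This replaces uniqueness of the element of
  minimal norm.\<close>

lemma orbit_hull_diff_small:
  assumes c: "\<And>h. h \<in> orbit_hull m f \<Longrightarrow> c \<le> (nrm h)\<^sup>2"
    and a: "a \<in> orbit_hull m f" "(nrm a)\<^sup>2 \<le> c + \<alpha>"
    and b: "b \<in> orbit_hull m f" "(nrm b)\<^sup>2 \<le> c + \<beta>"
  shows "(nrm (a - b))\<^sup>2 \<le> 2 * (\<alpha> + \<beta>)"
proof -
  have "(1 - 1 / 2) *\<^sub>R a + (1 / 2) *\<^sub>R b \<in> orbit_hull m f"
    by (rule orbit_hull.convex) (use a b in auto)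
  from c[OF this] have "4 * c \<le> ip a a + 2 * ip a b + ip b b"
    by (simp add: nrm_square ip_add_left ip_add_right ip_scale_left ip_scale_right ip_commute[of b a] field_simps)
  then show ?thesis
    using a(2) b(2)
    by (simp add: nrm_square ip_diff_left ip_diff_right ip_commute[of b a])
qed

text \<open>The infimum \<open>E m\<close> of the squared norms grows along divisibility and is
  bounded by \<open>(nrm f)\<^sup>2\<close>. If \<open>E m\<close> is almost the supremum, the hull
  of any nonzero multiple \<open>s\<close> has nearly the same infimum, and near-minimisers of both
  hulls are close to each other.\<close>

lemma almost_rational_part:
  assumes "\<epsilon> > 0"
  shows "\<exists>m::int. \<exists>f' \<in> orbit_hull m f. m \<ge> 1 \<and> (\<forall>j. nrm (T (m * j, 0) f' - f') \<le> \<epsilon>) \<and>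
    (\<forall>s. s \<noteq> 0 \<longrightarrow> m dvd s \<longrightarrow>
      (\<forall>\<^sub>F N in sequentially. nrm (av N (\<lambda>y. T (s * int y, 0) (f - f'))) \<le> \<epsilon>))"
proof -
  define E where "E m = Inf ((\<lambda>h. (nrm h)\<^sup>2) ` orbit_hull m f)" for m
  \<comment> \<open>Chosen so that
    \<open>2 * (2 * \<alpha> + \<alpha>) = (\<epsilon> / 2)\<^sup>2\<close> in
    \<open>close\<close>.\<close>
  define \<alpha> where "\<alpha> = \<epsilon>\<^sup>2 / 24"
  have \<alpha>: "\<alpha> > 0" using assms by (simp add: \<alpha>_def)
  have bdd: "bdd_below ((\<lambda>h. (nrm h)\<^sup>2) ` orbit_hull m f)" for m
    by (rule bdd_belowI[of _ 0]) auto
  have ne: "orbit_hull m f \<noteq> {}" for m using orbit_hull.base by blast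
  have E_le: "E m \<le> (nrm h)\<^sup>2" if "h \<in> orbit_hull m f" for h m
    unfolding E_def using bdd that by (intro cINF_lower)
  have E_attained: "\<exists>h \<in> orbit_hull m f. (nrm h)\<^sup>2 < E m + \<alpha>" for m
    using cINF_less_iff[OF ne bdd, of m "E m + \<alpha>"] \<alpha> by (simp add: E_def)
  have E_mono: "E m \<le> E m'" if "m dvd m'" for m m'
    unfolding E_def using that ne bdd by (intro cINF_superset_mono) (auto intro: orbit_hull_subset)
  have bddE: "bdd_above (E ` {1..})"
    by (rule bdd_aboveI[of _ "(nrm f)\<^sup>2"]) (auto intro: E_le orbit_hull.base)
  have "Sup (E ` {1..}) - \<alpha> < Sup (E ` {1..})" using \<alpha> by simp
  then obtain m where m: "m \<ge> 1" "Sup (E ` {1..}) - \<alpha> < E m"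
    by (subst (asm) less_cSup_iff) (use bddE in auto)
  have E_near: "E s < E m + \<alpha>" if "s \<noteq> 0" "m dvd s" for s
  proof -
    \<comment> \<open>The supremum runs over positive moduli only, so a negative \<open>s\<close> is
      replaced by its absolute value.\<close>
    have "E s \<le> E \<bar>s\<bar>" by (rule E_mono) simp
    also have "\<dots> \<le> Sup (E ` {1..})"
      using bddE that by (intro cSUP_upper) auto
    finally show ?thesis using m by simp
  qed
  obtain f' where f': "f' \<in> orbit_hull m f" "(nrm f')\<^sup>2 < E m + \<alpha>" using E_attained by blast
  have close: "nrm (a - b) \<le> \<epsilon> / 2"
    if "a \<in> orbit_hull m f" "b \<in> orbit_hull m f" "(nrm a)\<^sup>2 \<le> E m + 2 * \<alpha>" "(nrm b)\<^sup>2 \<le> E m + \<alpha>" for a b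
  proof (rule power2_le_imp_le)
    show "(nrm (a - b))\<^sup>2 \<le> (\<epsilon> / 2)\<^sup>2"
      using orbit_hull_diff_small[OF E_le that(1,3,2,4)] by (simp add: \<alpha>_def power_divide)
  qed (use assms in simp)
  have "nrm (T (m * j, 0) f' - f') \<le> \<epsilon>" for j
    using close[of "T (m * j, 0) f'" f'] f' \<alpha> assms orbit_hull.shift[OF f'(1)] by simp
  moreover have "\<forall>\<^sub>F N in sequentially. nrm (av N (\<lambda>y. T (s * int y, 0) (f - f'))) \<le> \<epsilon>"
    if s: "s \<noteq> 0" "m dvd s" for s
  proof -
    define A where "A h N = av N (\<lambda>y. T (s * int y, 0) h)" for h N
    \<comment> \<open>Averages of \<open>f\<close> may have large norm at first, but those of
      \<open>c\<close> never exceed \<open>nrm c\<close> and are asymptotically the same. Comparison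
      with \<open>f'\<close> therefore goes through \<open>c\<close>.\<close>
    obtain c where c: "c \<in> orbit_hull s f" "(nrm c)\<^sup>2 < E s + \<alpha>" using E_attained by blast
    have Ac: "A h N \<in> orbit_hull m f" "(nrm (A h N))\<^sup>2 \<le> (nrm h)\<^sup>2" if "h \<in> orbit_hull m f" "N > 0" for h N
    proof -
      show "A h N \<in> orbit_hull m f"
        using that s unfolding A_def by (intro orbit_hull_av orbit_hull_shift_dvd) auto
      show "(nrm (A h N))\<^sup>2 \<le> (nrm h)\<^sup>2"
        unfolding A_def by (intro power_mono nrm_av_le) auto
    qed
    have "\<forall>\<^sub>F N in sequentially. nrm (A c N - A f N) \<le> \<epsilon> / 2"
      unfolding A_def using c(1) assms by (intro orbit_hull_av_asymptotic) auto
    then show ?thesis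
      using eventually_gt_at_top[of 0]
    proof eventually_elim
      case (elim N)
      have cm: "c \<in> orbit_hull m f" using orbit_hull_subset s c by blast
      have "nrm (A c N - A f' N) \<le> \<epsilon> / 2"
      proof (rule close)
        show "(nrm (A c N))\<^sup>2 \<le> E m + 2 * \<alpha>"
          using Ac(2)[OF cm elim(2)] c(2) E_near[OF s] by linarith
        show "(nrm (A f' N))\<^sup>2 \<le> E m + \<alpha>"
          using Ac(2)[OF f'(1) elim(2)] f'(2) by linarith
      qed (use Ac(1) cm f'(1) elim in auto)
      then have "nrm (A f N - A f' N) \<le> \<epsilon>"
        using elim nrm_triangle_via[of "A f N" "A f' N" "A c N"] nrm_minus_commute[of "A f N" "A c N"] by simp
      then show ?case by (simp add: A_def T_diff av_diff)
    qed
  qed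
  ultimately show ?thesis using m(1) f'(1) by blast
qed

text \<open>
  The squared norms of the partial sums \<open>S N\<close> are at least \<open>N\<^sup>2 \<cdot> (ip h one)\<^sup>2\<close>, and their increments are
  controlled by the partial sums of the correlations.
\<close>

lemma frequently_correlation:
  assumes one: "\<And>v. T v one = one" "ip one one = 1" and d: "d < (ip h one)\<^sup>2"
  shows "\<exists>\<^sub>F N in sequentially. av N (\<lambda>y. ip h (T (0, m * int y) h)) > d"
proof (rule ccontr)
  define \<delta> where "\<delta> = (ip h one)\<^sup>2"
  define c where "c = (\<lambda>y::nat. ip h (T (0, m * int y) h))"
  define S where "S N = (\<Sum>y<N. T (0, m * int y) h)" for N :: nat
  assume "\<not> ?thesis"
  then have "\<forall>\<^sub>F N in sequentially. av N c \<le> d"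
    by (simp add: not_frequently not_less c_def)
  then obtain N0 where N0: "\<And>N. N \<ge> N0 \<Longrightarrow> av N c \<le> d"
    by (auto simp: eventually_sequentially)
  \<comment> \<open>The cross term is the sum of \<open>c 1\<close> to \<open>c N\<close>, and
    \<open>c 0\<close> is the squared norm of \<open>h\<close>. Doubling the whole sum counts
    \<open>c 0\<close> twice instead of once, which is harmless as
    \<open>c 0 \<ge> 0\<close>.\<close>
  have step: "ip (S (Suc N)) (S (Suc N)) \<le> ip (S N) (S N) + 2 * (\<Sum>y<Suc N. c y)" for N
  proof -
    have "ip (S N) (T (0, m * int N) h) = (\<Sum>y<N. c (N - y))"
      unfolding S_def ip_sum_left
      by (rule sum.cong) (auto simp: ip_T_T c_def algebra_simps of_nat_diff)
    also have "\<dots> = (\<Sum>y<N. c (Suc y))"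
      by (subst sum.nat_diff_reindex[symmetric]) (auto intro!: sum.cong simp: Suc_diff_Suc)
    also have "\<dots> = (\<Sum>y<Suc N. c y) - c 0"
      by (simp only: sum.lessThan_Suc_shift)
    finally have "ip (S N) (T (0, m * int N) h) = (\<Sum>y<Suc N. c y) - c 0" .
    moreover have "c 0 \<ge> 0" using ip_nonneg[of h] by (simp add: c_def T_zero flip: zero_prod_def)
    moreover have "c 0 = ip h h" by (simp add: c_def T_zero flip: zero_prod_def)
    ultimately show ?thesis
      by (simp add: S_def ip_add_left ip_add_right ip_T ip_commute[of "T _ h"])
  qed
  have lower: "(real N)\<^sup>2 * \<delta> \<le> ip (S N) (S N)" for N
  proof -
    have "ip (T v h) one = ip h one" for v
      using ip_T[of v h one] one(1) by simp
    then have "ip (S N) one = real N * ip h one" by (simp add: S_def ip_sum_left)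
    then show ?thesis
      using ip_square_le[of "S N" one] one(2) by (simp add: \<delta>_def power_mult_distrib)
  qed
  \<comment> \<open>The increments from \<open>N0\<close> on are at most
    \<open>2 * d * (N0 + i + 1)\<close>; the last factor is their sum in closed form.\<close>
  have upper: "ip (S (N0 + N)) (S (N0 + N)) \<le> ip (S N0) (S N0) + d * real N * (2 * real N0 + real N + 1)" for N
  proof (induction N)
    case (Suc N)
    have "(\<Sum>y<Suc (N0 + N). c y) \<le> d * real (Suc (N0 + N))"
      using N0[of "Suc (N0 + N)"] by (simp add: av_def field_simps)
    then show ?case
      using Suc step[of "N0 + N"] by (simp add: algebra_simps)
  qed simp
  \<comment> \<open>The leading coefficient is \<open>\<delta> - d > 0\<close>, so the lower bound
    eventually overtakes the upper one.\<close>
  have "filterlim (\<lambda>N. (real N0 + real N)\<^sup>2 * \<delta> - d * real N * (2 * real N0 + real N + 1)) at_top sequentially"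
  proof -
    define a where "a = \<delta> - d"
    have "a > 0" using d by (simp add: a_def \<delta>_def)
    have "filterlim (\<lambda>N. a * (real N)\<^sup>2 + (2 * real N0 * \<delta> - 2 * d * real N0 - d) * real N + (real N0)\<^sup>2 * \<delta>) at_top sequentially"
      using \<open>a > 0\<close> by real_asymp
    moreover have "(real N0 + real N)\<^sup>2 * \<delta> - d * real N * (2 * real N0 + real N + 1) =
        a * (real N)\<^sup>2 + (2 * real N0 * \<delta> - 2 * d * real N0 - d) * real N + (real N0)\<^sup>2 * \<delta>" for N
      by (simp add: a_def power2_eq_square algebra_simps)
    ultimately show ?thesis by simp
  qed
  then have "\<forall>\<^sub>F N in sequentially.
      ip (S N0) (S N0) < (real N0 + real N)\<^sup>2 * \<delta> - d * real N * (2 * real N0 + real N + 1)"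
    by (simp only: filterlim_at_top_dense)
  from eventually_happens'[OF sequentially_bot this] obtain N where
    "ip (S N0) (S N0) < (real N0 + real N)\<^sup>2 * \<delta> - d * real N * (2 * real N0 + real N + 1)"
    by blast
  then have "ip (S N0) (S N0) + d * real N * (2 * real N0 + real N + 1) < (real (N0 + N))\<^sup>2 * \<delta>"
    by (simp only: less_diff_eq of_nat_add)
  then show False using order_trans[OF lower upper] not_le by blast
qed

text \<open>Error budget: the main correlation average exceeds \<open>d / 2\<close> for suitable
  \<open>N\<close>; replacing \<open>f\<close> by \<open>f'\<close> and discarding
  \<open>f - f'\<close> cost at most \<open>d / 4\<close> each. The choices are made in the order
  \<open>e\<close>, \<open>\<epsilon>0\<close>, \<open>\<epsilon>\<close>, \<open>m\<close>.\<close>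

theorem polynomial_recurrence:
  assumes one: "\<And>v. T v one = one" "ip one one = 1" and f: "ip f one \<noteq> 0"
    and P: "degree P \<ge> 2" "poly P 0 = 0"
  shows "\<exists>k\<ge>1. \<forall>n. \<exists>y. ip f (T (k * n + poly P y, y) f) > 0"
proof -
  define d where "d = (ip f one)\<^sup>2"
  have d: "d > 0" using f by (simp add: d_def)
  define e where "e = d / (4 * (nrm f + 1))"
  have nf: "nrm f + 1 > 0" using nrm_nonneg[of f] by linarith
  then have e: "e > 0" "nrm f * e \<le> d / 4"
    using d by (auto simp: e_def field_simps)
  obtain n where n: "degree P = Suc (Suc n)"
    using P(1) by (metis add_2_eq_Suc le_Suc_ex)
  have "2 * nrm f \<ge> 0" by simp
  from polynomial_averages_small[OF e(1) this, of "Suc n"] obtain \<epsilon>0 where "\<epsilon>0 > 0"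
    and \<epsilon>0: "\<And>g m p a b. nrm g \<le> 2 * nrm f \<Longrightarrow> degree p = Suc (Suc n) \<Longrightarrow> \<forall>y. m dvd poly p y \<Longrightarrow>
    \<forall>s. s \<noteq> 0 \<longrightarrow> m dvd s \<longrightarrow> (\<forall>\<^sub>F N in sequentially. nrm (av N (\<lambda>y. T (s * int y, 0) g)) \<le> \<epsilon>0) \<Longrightarrow>
    \<forall>\<^sub>F N in sequentially. nrm (av N (\<lambda>y. T (poly p (int y), a * int y + b) g)) \<le> e"
    by auto
  define \<epsilon> where "\<epsilon> = min \<epsilon>0 (e / 2)"
  have "\<epsilon> > 0" "\<epsilon> \<le> \<epsilon>0" "nrm f * \<epsilon> \<le> d / 8"
  proof -
    have "nrm f * \<epsilon> \<le> nrm f * (e / 2)" by (intro mult_left_mono) (auto simp: \<epsilon>_def)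
    then show "nrm f * \<epsilon> \<le> d / 8" using e(2) by simp
  qed (use \<open>\<epsilon>0 > 0\<close> e in \<open>auto simp: \<epsilon>_def\<close>)
  from almost_rational_part[OF this(1), of f] obtain m :: int and f' where m: "m \<ge> 1"
    and f': "f' \<in> orbit_hull m f" "\<And>j. nrm (T (m * j, 0) f' - f') \<le> \<epsilon>"
    and rest: "\<And>s. s \<noteq> 0 \<Longrightarrow> m dvd s \<Longrightarrow>
      (\<forall>\<^sub>F N in sequentially. nrm (av N (\<lambda>y. T (s * int y, 0) (f - f'))) \<le> \<epsilon>)"
    by blast
  \<comment> \<open>Only the values \<open>m * y\<close> of the second coordinate are tested. As
    \<open>P\<close> has no constant term, \<open>m\<close> then divides every value of
    \<open>p\<close>.\<close>
  define p where "p = pcompose P [:0, m:]"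
  have p: "degree p = Suc (Suc n)" using m n by (simp add: p_def degree_pcompose)
  have poly_p: "poly p y = poly P (m * y)" for y by (simp add: p_def poly_pcompose mult.commute)
  have dvd_p: "m dvd poly p y" for y
  proof -
    obtain Q where "P = pCons 0 Q"
      using P(2) by (cases P) auto
    then show ?thesis by (simp add: poly_p)
  qed
  have "\<exists>y. ip f (T (m * k + poly P y, y) f) > 0" for k
  proof (rule ccontr)
    assume "\<not> ?thesis"
    then have neg: "ip f (T (m * k + poly P y, y) f) \<le> 0" for y by (meson not_less)
    have g: "nrm (f - f') \<le> 2 * nrm f"
      using nrm_triangle_diff[of f f'] orbit_hull_nrm_le[OF f'(1)] by simp
    have "\<forall>\<^sub>F N in sequentially. nrm (av N (\<lambda>y. T (s * int y, 0) (f - f'))) \<le> \<epsilon>0"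
      if "s \<noteq> 0" "m dvd s" for s
      using rest[OF that] by (rule eventually_mono) (use \<open>\<epsilon> \<le> \<epsilon>0\<close> in linarith)
    then have "\<forall>\<^sub>F N in sequentially. nrm (av N (\<lambda>y. T (poly p (int y), m * int y + 0) (f - f'))) \<le> e"
      using dvd_p by (intro \<epsilon>0[OF g p, of m]) auto
    moreover have "ip f' one = ip f one" using ip_orbit_hull_invariant[OF f'(1) one(1)] .
    then have "\<exists>\<^sub>F N in sequentially. av N (\<lambda>y. ip f' (T (0, m * int y) f')) > d / 2"
      using d by (intro frequently_correlation[OF one]) (simp add: d_def)
    \<comment> \<open>The correlation bound holds only for infinitely many \<open>N\<close>, the
      smallness of the rest for all large \<open>N\<close>; together they give a common
      \<open>N\<close>.\<close>
    ultimately have "\<exists>\<^sub>F N in sequentially. av N (\<lambda>y. ip f' (T (0, m * int y) f')) > d / 2 \<and>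
        nrm (av N (\<lambda>y. T (poly p (int y), m * int y + 0) (f - f'))) \<le> e \<and> N > 0"
      by (intro frequently_eventually_frequently eventually_conj eventually_gt_at_top)
    then obtain N where N: "av N (\<lambda>y. ip f' (T (0, m * int y) f')) > d / 2"
        "nrm (av N (\<lambda>y. T (poly p (int y), m * int y) (f - f'))) \<le> e" "N > 0"
      by (auto dest!: frequently_ex)
    define v where "v y = (m * k + poly p (int y), m * int y)" for y
    have split: "ip f (T (v y) f) = ip f (T (v y) f') + ip f (T (v y) (f - f'))" for y
      by (simp add: T_diff ip_diff_right)
    have main: "ip f (T (v y) f') \<ge> ip f' (T (0, m * int y) f') - d / 4" for y
    proof -
      define w where "w = T (0, m * int y) f'"
      have w: "nrm (T (m * j, 0) w - w) \<le> \<epsilon>" for j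
      proof -
        have "T (m * j, 0) w - w = T (0, m * int y) (T (m * j, 0) f' - f')"
          by (simp add: w_def T_T T_diff)
        then show ?thesis using f'(2) by simp
      qed
      obtain j where "poly p (int y) = m * j" using dvd_p by blast
      then have "T (v y) f' = T (m * (k + j), 0) w"
        by (simp add: v_def w_def T_T algebra_simps)
      \<comment> \<open>\<open>f\<close> and \<open>f'\<close> both lie in the hull of
        \<open>f\<close>, so both correlations are within \<open>d / 8\<close> of
        \<open>ip f w\<close>.\<close>
      then have "\<bar>ip f (T (v y) f') - ip f w\<bar> \<le> nrm f * \<epsilon>"
        using ip_orbit_hull_almost_invariant[OF orbit_hull.base w] by simp
      moreover have "\<bar>ip f' w - ip f w\<bar> \<le> nrm f * \<epsilon>"
        using ip_orbit_hull_almost_invariant[OF f'(1) w, of 0] by (simp add: T_zero flip: zero_prod_def)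
      ultimately show ?thesis
        using \<open>nrm f * \<epsilon> \<le> d / 8\<close> unfolding w_def by linarith
    qed
    \<comment> \<open>The dependence on \<open>k\<close> is a single isometry outside the average,
      which makes the estimate uniform in \<open>k\<close>.\<close>
    have "av N (\<lambda>y. T (v y) (f - f')) = T (m * k, 0) (av N (\<lambda>y. T (poly p (int y), m * int y) (f - f')))"
      by (simp add: T_av T_T v_def)
    then have "nrm (av N (\<lambda>y. T (v y) (f - f'))) \<le> e" using N(2) by simp
    then have "\<bar>ip f (av N (\<lambda>y. T (v y) (f - f')))\<bar> \<le> nrm f * e"
      using abs_ip_le order_trans mult_left_mono nrm_nonneg by meson
    then have 1: "av N (\<lambda>y. ip f (T (v y) (f - f'))) \<ge> - d / 4"
      using e(2) by (simp add: ip_av_right)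
    have "av N (\<lambda>y. ip f' (T (0, m * int y) f')) - d / 4 = av N (\<lambda>y. ip f' (T (0, m * int y) f') - d / 4)"
      using N(3) by (simp add: av_diff av_const)
    also have "\<dots> \<le> av N (\<lambda>y. ip f (T (v y) f'))"
      using main by (intro av_mono)
    finally have "av N (\<lambda>y. ip f (T (v y) f)) > 0"
      using N(1) 1 by (simp add: split av_add)
    moreover have "av N (\<lambda>y. ip f (T (v y) f)) \<le> av N (\<lambda>y. 0)"
      using neg by (intro av_mono) (simp add: v_def poly_p)
    ultimately show False by (simp add: av_def)
  qed
  then show ?thesis using m by blast
qed

end

section \<open>Compactness\<close>

text \<open>By Tychonoff the sequence of functions \<open>\<lambda>i. X i n\<close> has a cluster
  point in a product of compact intervals. A filter replaces a subsequence because the index type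
  may be uncountable.\<close>

lemma simultaneous_limit:
  fixes X :: "'i \<Rightarrow> nat \<Rightarrow> real"
  assumes "\<And>i. bounded (range (X i))"
  obtains G \<Lambda> where "G \<noteq> bot" "G \<le> sequentially" "\<And>i. (X i \<longlongrightarrow> \<Lambda> i) G"
proof -
  obtain K where K: "\<And>i n. \<bar>X i n\<bar> \<le> K i"
    using assms unfolding bounded_iff by (metis rangeI real_norm_def)
  define S where "S = PiE UNIV (\<lambda>i. {- K i..K i})"
  define Y where "Y n = (\<lambda>i. X i n)" for n
  have "compactin (product_topology (\<lambda>i. euclidean) UNIV) S"
    unfolding S_def compactin_PiE by simp
  then have "compact S" by (simp add: euclidean_product_topology)
  moreover have "Y n \<in> S" for n
    using K by (auto simp: S_def Y_def abs_le_iff minus_le_iff)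
  then have "eventually (\<lambda>h. h \<in> S) (filtermap Y sequentially)"
    by (simp add: eventually_filtermap)
  ultimately obtain \<Lambda> where \<Lambda>: "inf (nhds \<Lambda>) (filtermap Y sequentially) \<noteq> bot"
    unfolding compact_filter by (metis filtermap_bot_iff sequentially_bot)
  define G where "G = inf (filtercomap Y (nhds \<Lambda>)) sequentially"
  have "G \<noteq> bot"
  proof
    assume "G = bot"
    then have "eventually (\<lambda>_. False) G" by simp
    then obtain P Q where P: "eventually P (nhds \<Lambda>)" and Q: "eventually Q sequentially"
      and PQ: "\<And>n. P (Y n) \<Longrightarrow> Q n \<Longrightarrow> False"
      unfolding G_def eventually_inf eventually_filtercomap by blast
    have "eventually (\<lambda>h. \<not> P h) (filtermap Y sequentially)"
      unfolding eventually_filtermap using Q by (rule eventually_mono) (use PQ in blast)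
    then have "eventually (\<lambda>_. False) (inf (nhds \<Lambda>) (filtermap Y sequentially))"
      unfolding eventually_inf using P by blast
    then show False using \<Lambda> by (simp add: eventually_False)
  qed
  moreover have "G \<le> sequentially" by (simp add: G_def)
  moreover have "(X i \<longlongrightarrow> \<Lambda> i) G" for i
  proof -
    have Y: "filterlim Y (nhds \<Lambda>) G"
      unfolding G_def by (rule filterlim_mono[OF filterlim_filtercomap order_refl inf_le1])
    have "((\<lambda>n. Y n i) \<longlongrightarrow> \<Lambda> i) G"
    proof (rule topological_tendstoI)
      fix U assume U: "open U" "\<Lambda> i \<in> U"
      have "open ((\<lambda>h. h i) -` U)"
        by (rule open_vimage[OF U(1) continuous_on_product_coordinates])
      then have "eventually (\<lambda>h. h \<in> (\<lambda>h. h i) -` U) (nhds \<Lambda>)"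
        using U(2) by (intro eventually_nhds_in_open) auto
      with Y show "eventually (\<lambda>n. Y n i \<in> U) G"
        unfolding filterlim_iff by fastforce
    qed
    then show ?thesis by (simp add: Y_def)
  qed
  ultimately show thesis using that by blast
qed

subsection \<open>The correlation form of a dense set\<close>

text \<open>The plane lattice is discrete, so the type of bounded continuous functions contains
  every bounded function on it.\<close>

lemma continuous_on_int_prod [simp]: "continuous_on S (f :: int \<times> int \<Rightarrow> 'b::topological_space)"
proof -
  have "open A" for A :: "(int \<times> int) set"
  proof -
    have "A = (\<Union>p\<in>A. {fst p} \<times> {snd p})" by auto
    also have "open \<dots>" by (intro open_UN open_Times ballI open_discrete)
    finally show ?thesis .
  qed
  then show ?thesis by (auto simp: continuous_on_open_invariant intro!: exI)
qed

definition translate :: "int \<times> int \<Rightarrow> ((int \<times> int) \<Rightarrow>\<^sub>C real) \<Rightarrow> ((int \<times> int) \<Rightarrow>\<^sub>C real)" where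
  "translate v f = Bcontfun (\<lambda>z. apply_bcontfun f (z + v))"

lemma apply_translate: "apply_bcontfun (translate v f) z = apply_bcontfun f (z + v)"
proof -
  have "bounded (range (\<lambda>z. apply_bcontfun f (z + v)))"
    by (rule bounded_subset[OF bounded_apply_bcontfun[of f]]) auto
  then show ?thesis by (simp add: translate_def Bcontfun_inverse bcontfun_def)
qed

lemma apply_Bcontfun_indicator: "apply_bcontfun (Bcontfun (indicator B)) = (indicator B :: int \<times> int \<Rightarrow> real)"
  by (rule Bcontfun_inverse) (auto simp: bcontfun_def bounded_iff indicator_def intro!: exI[of _ 1])

lemma box2_eq: "box2 x R = {fst x..<fst x + int R} \<times> {snd x..<snd x + int R}"
  by (auto simp: box2_def)

lemma finite_box2 [simp]: "finite (box2 x R)"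
  by (simp add: box2_eq)

lemma card_box2: "card (box2 x R) = R\<^sup>2"
  by (simp add: box2_eq power2_eq_square)

definition box_mean :: "int \<times> int \<Rightarrow> nat \<Rightarrow> (int \<times> int \<Rightarrow> real) \<Rightarrow> real" where
  "box_mean x R g = (\<Sum>z\<in>box2 x R. g z) / (real R)\<^sup>2"

lemma abs_box_mean_le:
  assumes "\<And>z. \<bar>g z\<bar> \<le> C"
  shows "\<bar>box_mean x R g\<bar> \<le> C"
proof -
  have C: "C \<ge> 0" using assms[of 0] by linarith
  have "\<bar>\<Sum>z\<in>box2 x R. g z\<bar> \<le> (\<Sum>z\<in>box2 x R. C)"
    by (intro order_trans[OF sum_abs] sum_mono assms)
  then have "\<bar>\<Sum>z\<in>box2 x R. g z\<bar> / (real R)\<^sup>2 \<le> C * (real R)\<^sup>2 / (real R)\<^sup>2"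
    by (intro divide_right_mono) (simp_all add: card_box2 mult.commute)
  \<comment> \<open>Not an equality: for \<open>R = 0\<close> the quotient is
    \<open>0\<close>.\<close>
  also have "\<dots> \<le> C" using C by simp
  finally show ?thesis by (simp add: box_mean_def)
qed

lemma sum_int_telescope:
  fixes G :: "int \<Rightarrow> real"
  shows "(\<Sum>i\<in>{a..<a + int R}. G (i + 1) - G i) = G (a + int R) - G a"
proof (induction R)
  case (Suc R)
  have "{a..<a + int (Suc R)} = insert (a + int R) {a..<a + int R}" by auto
  then show ?case using Suc by (simp add: algebra_simps)
qed simp

text \<open>The sum telescopes in the direction of \<open>e\<close> and leaves two opposite faces of
  the box with \<open>R\<close> points each.\<close>

lemma box_mean_shift_unit:
  assumes g: "\<And>z. \<bar>g z\<bar> \<le> C" and e: "e = (1, 0) \<or> e = (0, 1)"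
  shows "\<bar>box_mean x R (\<lambda>z. g (z + e)) - box_mean x R g\<bar> \<le> 2 * C / real R"
proof -
  define I where "I a = {a..<a + int R}" for a
  have telescope: "\<bar>\<Sum>i\<in>I a. \<Sum>j\<in>I b. h (i + 1) j - h i j\<bar> \<le> real R * (2 * C)"
    if h: "\<And>i j. \<bar>h i j\<bar> \<le> C" for a b and h :: "int \<Rightarrow> int \<Rightarrow> real"
  proof -
    have "(\<Sum>i\<in>I a. \<Sum>j\<in>I b. h (i + 1) j - h i j) = (\<Sum>j\<in>I b. h (a + int R) j - h a j)"
      unfolding I_def by (subst sum.swap) (intro sum.cong refl sum_int_telescope[of "\<lambda>i. h i _"])
    also have "\<bar>\<dots>\<bar> \<le> (\<Sum>j\<in>I b. 2 * C)"
    proof (intro order_trans[OF sum_abs] sum_mono)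
      show "\<bar>h (a + int R) j - h a j\<bar> \<le> 2 * C" for j
        using h[of "a + int R" j] h[of a j] by linarith
    qed
    finally show ?thesis by (simp add: I_def)
  qed
  have "\<bar>\<Sum>z\<in>box2 x R. g (z + e) - g z\<bar> \<le> real R * (2 * C)"
    using e
  proof
    assume "e = (1, 0)"
    then show ?thesis
      using telescope[where h = "\<lambda>i j. g (i, j)" and a = "fst x" and b = "snd x"] g
      by (simp add: box2_eq I_def sum.cartesian_product case_prod_unfold plus_prod_def)
  next
    assume "e = (0, 1)"
    moreover have "\<bar>\<Sum>j\<in>I (fst x). \<Sum>i\<in>I (snd x). g (j, i + 1) - g (j, i)\<bar> \<le> real R * (2 * C)"
      by (subst sum.swap) (rule telescope, rule g)
    ultimately show ?thesis
      by (simp add: box2_eq I_def sum.cartesian_product case_prod_unfold plus_prod_def)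
  qed
  then have "\<bar>\<Sum>z\<in>box2 x R. g (z + e) - g z\<bar> / (real R)\<^sup>2 \<le> real R * (2 * C) / (real R)\<^sup>2"
    by (rule divide_right_mono) simp
  also have "\<dots> = 2 * C / real R" by (simp add: power2_eq_square)
  finally show ?thesis
    by (simp add: box_mean_def sum_subtractf flip: diff_divide_distrib)
qed

text \<open>The algebraic laws hold for the box means and pass to the limit. Invariance holds only
  in the limit: a unit shift costs a boundary term of order \<open>1 / R\<close>, and the vectors
  \<open>v\<close> leaving \<open>\<Lambda>\<close> invariant form a group containing both unit
  vectors.\<close>

lemma exists_correlation_form:
  fixes x :: "nat \<Rightarrow> int \<times> int" and R :: "nat \<Rightarrow> nat"
  assumes R: "filterlim R at_top sequentially"
  obtains G \<Lambda> where "G \<noteq> bot" "G \<le> sequentially" "isometric_action \<Lambda> translate"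
    "\<And>a b. ((\<lambda>n. box_mean (x n) (R n) (\<lambda>z. apply_bcontfun a z * apply_bcontfun b z)) \<longlongrightarrow> \<Lambda> a b) G"
proof -
  define M where "M a b n = box_mean (x n) (R n) (\<lambda>z. apply_bcontfun a z * apply_bcontfun b z)"
    for a b n
  have bounds: "\<exists>C. \<forall>z. \<bar>apply_bcontfun a z * apply_bcontfun b z\<bar> \<le> C" for a b :: "(int \<times> int) \<Rightarrow>\<^sub>C real"
  proof -
    have "\<bar>apply_bcontfun a z * apply_bcontfun b z\<bar> \<le> norm a * norm b" for z
      using norm_bounded[of a z] norm_bounded[of b z] by (simp add: abs_mult mult_mono)
    then show ?thesis by blast
  qed
  have "bounded (range (\<lambda>n. M a b n))" for a b
    unfolding bounded_iff M_def using bounds[of a b] abs_box_mean_le by (metis (no_types, lifting) imageE real_norm_def)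
  then have "\<And>i. bounded (range (\<lambda>n. M (fst i) (snd i) n))" .
  then obtain G \<Lambda> where G: "G \<noteq> bot" "G \<le> sequentially"
    and "\<And>i. ((\<lambda>n. M (fst i) (snd i) n) \<longlongrightarrow> \<Lambda> i) G"
    using simultaneous_limit[of "\<lambda>i n. M (fst i) (snd i) n"] by blast
  from this(3)[of "(_, _)"] have lim: "(M a b \<longlongrightarrow> \<Lambda> (a, b)) G" for a b by simp
  have unit: "\<Lambda> (translate e a, translate e b) = \<Lambda> (a, b)" if e: "e = (1, 0) \<or> e = (0, 1)" for e a b
  proof -
    obtain C where C: "\<And>z. \<bar>apply_bcontfun a z * apply_bcontfun b z\<bar> \<le> C" using bounds by blast
    have bound: "norm (M (translate e a) (translate e b) n - M a b n) \<le> 2 * C / real (R n)" for n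
      using box_mean_shift_unit[OF C e, of "x n" "R n"] by (simp add: M_def apply_translate)
    have "(\<lambda>n. 2 * C / real (R n)) \<longlonglongrightarrow> 0"
      by (intro real_tendsto_divide_at_top[OF tendsto_const] filterlim_compose[OF filterlim_real_sequentially R])
    then have lim0: "((\<lambda>n. 2 * C / real (R n)) \<longlongrightarrow> 0) G"
      by (rule tendsto_mono[OF G(2)])
    have "((\<lambda>n. M (translate e a) (translate e b) n - M a b n) \<longlongrightarrow> 0) G"
      by (rule Lim_null_comparison[OF always_eventually lim0]) (use bound in blast)
    moreover have "((\<lambda>n. M (translate e a) (translate e b) n - M a b n)
        \<longlongrightarrow> \<Lambda> (translate e a, translate e b) - \<Lambda> (a, b)) G"
      by (intro tendsto_diff lim)
    ultimately show ?thesis using tendsto_unique[OF G(1)] by fastforce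
  qed
  have plus: "translate (u + v) a = translate u (translate v a)" for u v a
    by (rule bcontfun_eqI) (simp add: apply_translate add.assoc)
  have zero: "translate 0 a = a" for a
    by (rule bcontfun_eqI) (simp add: apply_translate)
  define inv where "inv v \<longleftrightarrow> (\<forall>a b. \<Lambda> (translate v a, translate v b) = \<Lambda> (a, b))" for v
  have inv_plus: "inv (u + v)" if "inv u" "inv v" for u v
    using that by (simp add: inv_def plus)
  have inv_minus: "inv (- v)" if "inv v" for v
    unfolding inv_def
  proof (intro allI)
    fix a b
    have "\<Lambda> (translate v (translate (- v) a), translate v (translate (- v) b)) =
        \<Lambda> (translate (- v) a, translate (- v) b)"
      using that by (simp add: inv_def)
    then show "\<Lambda> (translate (- v) a, translate (- v) b) = \<Lambda> (a, b)"
      by (simp add: zero flip: plus)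
  qed
  have multiples: "inv (i * p, i * q)" if "inv (p, q)" for i p q
  proof (induction i rule: int_induct[where k = 0])
    case base
    then show ?case by (simp add: inv_def zero flip: zero_prod_def)
  next
    case (step1 i)
    then show ?case using inv_plus[OF _ that, of "(i * p, i * q)"] by (simp add: algebra_simps)
  next
    case (step2 i)
    then show ?case using inv_plus[OF _ inv_minus[OF that], of "(i * p, i * q)"] by (simp add: algebra_simps)
  qed
  have inv: "inv v" for v
  proof -
    have "inv (1, 0)" "inv (0, 1)" using unit by (auto simp: inv_def)
    from inv_plus[OF multiples[OF this(1), of "fst v"] multiples[OF this(2), of "snd v"]]
    show ?thesis by simp
  qed
  have "isometric_action (\<lambda>a b. \<Lambda> (a, b)) translate"
  proof
    fix a b c :: "(int \<times> int) \<Rightarrow>\<^sub>C real" and r u v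
    show "\<Lambda> (a, b) = \<Lambda> (b, a)"
    proof (rule tendsto_unique[OF G(1) lim])
      show "(M a b \<longlongrightarrow> \<Lambda> (b, a)) G"
        using lim[of b a] by (simp add: M_def[abs_def] mult.commute)
    qed
    have "M (a + b) c = (\<lambda>n. M a c n + M b c n)"
      by (simp add: fun_eq_iff M_def box_mean_def distrib_right sum.distrib add_divide_distrib)
    then have "(M (a + b) c \<longlongrightarrow> \<Lambda> (a, c) + \<Lambda> (b, c)) G"
      by (simp add: tendsto_add lim)
    then show "\<Lambda> (a + b, c) = \<Lambda> (a, c) + \<Lambda> (b, c)"
      by (rule tendsto_unique[OF G(1) lim])
    have "M (r *\<^sub>R a) c = (\<lambda>n. r * M a c n)"
      by (simp add: fun_eq_iff M_def box_mean_def sum_distrib_left mult.assoc)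
    then have "(M (r *\<^sub>R a) c \<longlongrightarrow> r * \<Lambda> (a, c)) G"
      by (simp add: tendsto_mult_left lim)
    then show "\<Lambda> (r *\<^sub>R a, c) = r * \<Lambda> (a, c)"
      by (rule tendsto_unique[OF G(1) lim])
    have "M a a n \<ge> 0" for n
      by (simp add: M_def box_mean_def sum_nonneg)
    then show "0 \<le> \<Lambda> (a, a)"
      using tendsto_lowerbound[OF lim[of a a] _ G(1)] by simp
    show "translate v (a + b) = translate v a + translate v b"
      by (rule bcontfun_eqI) (simp add: apply_translate)
    show "translate v (r *\<^sub>R a) = r *\<^sub>R translate v a"
      by (rule bcontfun_eqI) (simp add: apply_translate)
  qed (use plus zero inv in \<open>auto simp: inv_def\<close>)
  then show thesis
    using that[OF G, of "\<lambda>a b. \<Lambda> (a, b)"] lim unfolding M_def by blast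
qed

text \<open>Take \<open>\<delta>\<close> strictly between \<open>0\<close> and the density. If all
  boxes of side at least some \<open>n\<close> had mean below \<open>\<delta>\<close>, the limsup
  would not exceed \<open>\<delta>\<close>.\<close>

lemma upper_banach_density2_posD:
  assumes "upper_banach_density2 B > 0"
  obtains \<delta> x R where "\<delta> > 0" "filterlim R at_top sequentially"
    "\<And>n::nat. \<delta> \<le> box_mean (x n) (R n) (indicator B)"
proof -
  obtain \<delta> where \<delta>: "0 < ereal \<delta>" "ereal \<delta> < upper_banach_density2 B"
    using assms ereal_dense2 by blast
  have "\<exists>R x. n \<le> R \<and> \<delta> \<le> box_mean x R (indicator B)" for n
  proof (rule ccontr)
    assume "\<not> ?thesis"
    then have neg: "box_mean x R (indicator B) < \<delta>" if "n \<le> R" for R x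
      using that by (meson not_less)
    have "(SUP x. ereal (real (card (B \<inter> box2 x R)) / (real R)\<^sup>2)) \<le> ereal \<delta>" if "n \<le> R" for R
    proof (rule SUP_least)
      fix x
      have "box_mean x R (indicator B) = real (card (B \<inter> box2 x R)) / (real R)\<^sup>2"
        by (simp add: box_mean_def indicator_def sum.If_cases Int_commute)
      then show "ereal (real (card (B \<inter> box2 x R)) / (real R)\<^sup>2) \<le> ereal \<delta>"
        using neg[OF that, of x] by simp
    qed
    then have "upper_banach_density2 B \<le> ereal \<delta>"
      unfolding upper_banach_density2_def
      by (intro Limsup_bounded) (auto simp: eventually_sequentially)
    then show False using \<delta>(2) by simp
  qed
  then obtain R x where "\<And>n. n \<le> R n" "\<And>n. \<delta> \<le> box_mean (x n) (R n) (indicator B)"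
    by metis
  moreover from this(1) have "filterlim R at_top sequentially"
    by (intro filterlim_at_top_mono[OF filterlim_ident]) auto
  ultimately show thesis using that[of \<delta> R x] \<delta>(1) by simp
qed

subsection \<open>Conclusion\<close>

theorem theorem1p14:
  fixes P :: "int poly" and B :: "(int \<times> int) set"
  assumes "degree P \<ge> 2"
    and "poly P 0 = 0"
    and "upper_banach_density2 B > 0"
  shows "\<exists>k::int. k \<ge> 1 \<and>
           {k * m | m. True} \<subseteq> (\<lambda>(x, y). x - poly P y) ` diffset B"
proof -
  obtain \<delta> x R where \<delta>: "\<delta> > 0" and R: "filterlim R at_top sequentially"
    and dens: "\<And>n::nat. \<delta> \<le> box_mean (x n) (R n) (indicator B)"
    using upper_banach_density2_posD[OF assms(3)] by metis
  obtain G \<Lambda> where G: "G \<noteq> bot" "G \<le> sequentially" and action: "isometric_action \<Lambda> translate"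
    and lim: "\<And>a b. ((\<lambda>n. box_mean (x n) (R n) (\<lambda>z. apply_bcontfun a z * apply_bcontfun b z)) \<longlongrightarrow> \<Lambda> a b) G"
    by (rule exists_correlation_form[OF R, of x]) (rule that)
  interpret isometric_action \<Lambda> translate by (rule action)
  define f :: "(int \<times> int) \<Rightarrow>\<^sub>C real" where "f = Bcontfun (indicator B)"
  have f: "apply_bcontfun f = indicator B" by (simp add: f_def apply_Bcontfun_indicator)
  define one :: "(int \<times> int) \<Rightarrow>\<^sub>C real" where "one = const_bcontfun 1"
  have one: "apply_bcontfun one z = 1" for z by (simp add: one_def const_bcontfun.rep_eq)
  have "translate v one = one" for v
    by (rule bcontfun_eqI) (simp add: apply_translate one)
  moreover have "\<Lambda> one one = 1"
  proof (rule tendsto_unique[OF G(1) lim])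
    \<comment> \<open>An empty box has mean \<open>0\<close> instead of \<open>1\<close>.\<close>
    have "\<forall>\<^sub>F n in G. R n > 0"
      by (rule filter_leD[OF G(2)]) (rule eventually_compose_filterlim[OF eventually_gt_at_top R])
    then show "((\<lambda>n. box_mean (x n) (R n) (\<lambda>z. apply_bcontfun one z * apply_bcontfun one z)) \<longlongrightarrow> 1) G"
      by (intro tendsto_eventually) (auto elim!: eventually_mono simp: one box_mean_def card_box2)
  qed
  moreover have "\<Lambda> f one \<ge> \<delta>"
    by (rule tendsto_lowerbound[OF lim _ G(1)]) (use dens in \<open>simp add: f one\<close>)
  then have "\<Lambda> f one \<noteq> 0" using \<delta> by simp
  ultimately obtain k where k: "k \<ge> 1" "\<And>n. \<exists>y. \<Lambda> f (translate (k * n + poly P y, y) f) > 0"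
    using polynomial_recurrence[OF _ _ _ assms(1,2), of one f] by blast
  have "k * n \<in> (\<lambda>(x, y). x - poly P y) ` diffset B" for n
  proof -
    obtain y where y: "\<Lambda> f (translate (k * n + poly P y, y) f) > 0" using k(2) by blast
    define v where "v = (k * n + poly P y, y)"
    \<comment> \<open>Otherwise the product of \<open>f\<close> and its translate vanishes
      identically, and so does the limit.\<close>
    have "\<exists>z. z \<in> B \<and> z + v \<in> B"
    proof (rule ccontr)
      assume "\<not> ?thesis"
      then have "(\<lambda>z. apply_bcontfun f z * apply_bcontfun (translate v f) z) = (\<lambda>z. 0)"
        by (auto simp: f apply_translate indicator_def)
      then have "((\<lambda>n. 0) \<longlongrightarrow> \<Lambda> f (translate v f)) G"
        using lim[of f "translate v f"] by (simp add: box_mean_def)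
      then have "\<Lambda> f (translate v f) = 0"
        by (rule tendsto_unique[OF G(1) _ tendsto_const])
      then show False using y by (simp add: v_def)
    qed
    then obtain z where "z \<in> B" "z + v \<in> B" by blast
    moreover have "v = (z + v) - z" by simp
    ultimately have "v \<in> diffset B" unfolding diffset_def by blast
    \<comment> \<open>At \<open>v\<close> the terms \<open>poly P y\<close> cancel and leave
      \<open>k * n\<close>.\<close>
    then show ?thesis by (force simp: v_def)
  qed
  then show ?thesis using k(1) by blast
qed

end
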